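(* Let $(\mathcal M,g)$ be a smooth Riemannian manifold, and let $(x_0,x_1,r,t)$ be sampled with $x_0,x_1\in\mathcal M$ and $0\le r<t\le 1$. Let $\gamma$, $x_t=\gamma(t)$, $v(x_t,t)$, $u(x_t,r,t)$ and $\nabla_{\dot\gamma(t)}u(x_t,r,t)$ be the interpolation path, its point at time $t$, the instantaneous velocity, the average velocity and its covariant derivative along $\gamma$, as defined in the context. Let $u_\theta(x_t,r,t)\in T_{x_t}\mathcal M$ be a neural network with parameters $\theta$, and define the RMF objective $$\mathcal L_{\mathrm{RMF}}=\mathbb E_{x_0,x_1,r,t}\Big[\big\|u_\theta(x_t,r,t)-u(x_t,r,t)\big\|_g^2\Big].$$ Then the RMF objective can be written as $$\mathcal L_{\mathrm{RMF}}=\underbrace{\mathbb E_{x_0,x_1,r,t}\Big[\big\|u_\theta(x_t,r,t)-v(x_t,t)\big\|_g^2\Big]}_{\mathcal L_1(\theta)}+\underbrace{2\,\mathbb E_{x_0,x_1,r,t}\Big[\big\langle u_\theta(x_t,r,t),\,(t-r)\nabla_{\dot\gamma(t)}u(x_t,r,t)\big\rangle_g\Big]}_{\mathcal L_2(\theta)}+C ,$$ where $C$ does not depend on $\theta$.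
   Context: Here $x_1\sim p_1$ (the data distribution on $\mathcal M$) and $x_0\sim p_0$ (a base distribution on $\mathcal M$). The interpolation path is $\gamma(\tau)=x_\tau=\operatorname{Exp}_{x_1}\big(\kappa(\tau)\operatorname{Log}_{x_1}(x_0)\big)$, where $\operatorname{Exp}$ and $\operatorname{Log}$ are the Riemannian exponential and logarithm maps and $\kappa:[0,1]\to[0,1]$ is monotone decreasing with $\kappa(0)=1$, $\kappa(1)=0$ (typically $\kappa(\tau)=1-\tau$). The instantaneous velocity is $v(x_\tau,\tau)=\dot x_\tau=\dot\gamma(\tau)\in T_{x_\tau}\mathcal M$. The average velocity is $$u(x_t,r,t)=\frac{1}{t-r}\int_r^t\mathcal P^{\gamma}_{\tau\to t}\big(v(x_\tau,\tau)\big)\,\mathrm d\tau\in T_{x_t}\mathcal M,$$ where $\mathcal P^\gamma_{\tau\to t}:T_{x_\tau}\mathcal M\to T_{x_t}\mathcal M$ is parallel transport along $\gamma$ for the Levi-Civita connection. $\nabla_{\dot\gamma(t)}u(x_t,r,t)$ is the covariant derivative along $\gamma$ at time $t$ of the vector field $t\mapsto u(x_t,r,t)$ ($r$ fixed). The average velocity satisfies the identity $u(x_t,r,t)=v(x_t,t)-(t-r)\nabla_{\dot\gamma(t)}u(x_t,r,t)$, which may be used as known. $v$, $u$ and the sampling distribution of $(x_0,x_1,r,t)$ do not involve $\theta$. $\langle\cdot,\cdot\rangle_g$ and $\|\cdot\|_g$ denote the inner product and norm on $T_{x_t}\mathcal M$ given by $g$. *)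

theory Defs
  imports "HOL-Probability.Probability"
begin

section \<open>Smooth manifolds and tangent vectors\<close>

text \<open>\<open>f\<close> is of class \<open>C\<^sup>k\<close> on the open set \<open>S\<close>; derivatives are iterated in fixed
  directions, which in finite dimension is the usual notion.\<close>

primrec Ck_on :: "nat \<Rightarrow> ('a::euclidean_space \<Rightarrow> 'b::euclidean_space) \<Rightarrow> 'a set \<Rightarrow> bool" where
  "Ck_on 0 f S \<longleftrightarrow> continuous_on S f"
| "Ck_on (Suc k) f S \<longleftrightarrow>
     (\<forall>x\<in>S. f differentiable (at x)) \<and> (\<forall>v. Ck_on k (\<lambda>x. frechet_derivative f (at x) v) S)"

definition smooth_on :: "('a::euclidean_space \<Rightarrow> 'b::euclidean_space) \<Rightarrow> 'a set \<Rightarrow> bool" where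
  "smooth_on f S \<longleftrightarrow> (\<forall>k. Ck_on k f S)"

record ('m, 'e) chart =
  chart_dom :: "'m set"
  chart_map :: "'m \<Rightarrow> 'e"

definition chart_inv :: "('m, 'e) chart \<Rightarrow> 'e \<Rightarrow> 'm" where
  "chart_inv c = inv_into (chart_dom c) (chart_map c)"

definition is_chart :: "('m::topological_space, 'e::euclidean_space) chart \<Rightarrow> bool" where
  "is_chart c \<longleftrightarrow> open (chart_dom c) \<and> open (chart_map c ` chart_dom c) \<and>
     homeomorphism (chart_dom c) (chart_map c ` chart_dom c) (chart_map c) (chart_inv c)"

definition transition :: "('m, 'e) chart \<Rightarrow> ('m, 'e) chart \<Rightarrow> 'e \<Rightarrow> 'e" where
  "transition c d = chart_map d \<circ> chart_inv c"

definition smooth_atlas :: "('m::topological_space, 'e::euclidean_space) chart set \<Rightarrow> bool" where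
  "smooth_atlas \<A> \<longleftrightarrow>
     (\<forall>c\<in>\<A>. is_chart c) \<and> (\<Union>c\<in>\<A>. chart_dom c) = UNIV \<and>
     (\<forall>c\<in>\<A>. \<forall>d\<in>\<A>. smooth_on (transition c d) (chart_map c ` (chart_dom c \<inter> chart_dom d)))"

text \<open>The underlying space of a manifold is a whole type \<open>'m\<close>. The tangent space at \<open>p\<close> is the
  vector space \<open>'e\<close>: a tangent vector at \<open>p\<close> is stored as its components in one fixed chart
  \<open>chart_at M p\<close> around \<open>p\<close>. Components in another chart are obtained from these by the
  derivative of the transition map. The field \<open>ginner\<close> is the Riemannian metric, that is,
  \<open>ginner M p v w\<close> is the inner product of the tangent vectors \<open>v\<close> and \<open>w\<close> at \<open>p\<close>.\<close>

record ('m, 'e) riemannian =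
  atlas :: "('m, 'e) chart set"
  ginner :: "'m \<Rightarrow> 'e \<Rightarrow> 'e \<Rightarrow> real"

definition chart_at :: "('m, 'e) riemannian \<Rightarrow> 'm \<Rightarrow> ('m, 'e) chart" where
  "chart_at M p = (SOME c. c \<in> atlas M \<and> p \<in> chart_dom c)"

definition tangent_change ::
    "('m, 'e::euclidean_space) chart \<Rightarrow> ('m, 'e) chart \<Rightarrow> 'm \<Rightarrow> 'e \<Rightarrow> 'e" where
  "tangent_change c d p = frechet_derivative (transition c d) (at (chart_map c p))"

definition components ::
    "('m, 'e::euclidean_space) riemannian \<Rightarrow> ('m, 'e) chart \<Rightarrow> 'm \<Rightarrow> 'e \<Rightarrow> 'e" where
  "components M c p v = tangent_change (chart_at M p) c p v"

definition ginner_in ::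
    "('m, 'e::euclidean_space) riemannian \<Rightarrow> ('m, 'e) chart \<Rightarrow> 'e \<Rightarrow> 'e \<Rightarrow> 'e \<Rightarrow> real" where
  "ginner_in M c x a b =
     (let p = chart_inv c x; J = tangent_change c (chart_at M p) p in ginner M p (J a) (J b))"

definition riemannian_manifold ::
    "('m::{t2_space, second_countable_topology}, 'e::euclidean_space) riemannian \<Rightarrow> bool" where
  "riemannian_manifold M \<longleftrightarrow>
     smooth_atlas (atlas M) \<and>
     (\<forall>p. bilinear (ginner M p) \<and> (\<forall>v w. ginner M p v w = ginner M p w v) \<and>
          (\<forall>v. v \<noteq> 0 \<longrightarrow> ginner M p v v > 0)) \<and>
     (\<forall>c\<in>atlas M. \<forall>a b. smooth_on (\<lambda>x. ginner_in M c x a b) (chart_map c ` chart_dom c))"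

definition gnorm :: "('m, 'e) riemannian \<Rightarrow> 'm \<Rightarrow> 'e \<Rightarrow> real" where
  "gnorm M p v = sqrt (ginner M p v v)"

section \<open>Levi-Civita connection along curves\<close>

text \<open>Curves are parametrised by \<open>{0..1}\<close>, with one-sided derivatives at the end points. A vector
  field along \<open>\<gamma>\<close> is a function \<open>X\<close> with \<open>X s\<close> a tangent vector at \<open>\<gamma> s\<close>.\<close>

definition velocity ::
    "('m, 'e::euclidean_space) riemannian \<Rightarrow> (real \<Rightarrow> 'm) \<Rightarrow> real \<Rightarrow> 'e" where
  "velocity M \<gamma> t =
     vector_derivative (\<lambda>s. chart_map (chart_at M (\<gamma> t)) (\<gamma> s)) (at t within {0..1})"

definition differentiable_curve ::
    "('m::topological_space, 'e::euclidean_space) riemannian \<Rightarrow> (real \<Rightarrow> 'm) \<Rightarrow> bool" where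
  "differentiable_curve M \<gamma> \<longleftrightarrow> continuous_on {0..1} \<gamma> \<and>
     (\<forall>t\<in>{0..1}. (\<lambda>s. chart_map (chart_at M (\<gamma> t)) (\<gamma> s)) differentiable (at t within {0..1}))"

text \<open>The Christoffel symbols of the Levi-Civita connection in the chart \<open>c\<close>, as a bilinear map:
  \<open>christoffel M c x a b\<close> has components \<open>\<Gamma>\<^sup>k\<^sub>i\<^sub>j a\<^sup>i b\<^sup>j\<close> and is determined by the Koszul formula for
  constant coordinate fields.\<close>

definition christoffel ::
    "('m, 'e::euclidean_space) riemannian \<Rightarrow> ('m, 'e) chart \<Rightarrow> 'e \<Rightarrow> 'e \<Rightarrow> 'e \<Rightarrow> 'e" where
  "christoffel M c x a b = (THE z. \<forall>y. ginner_in M c x z y =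
     (frechet_derivative (\<lambda>x'. ginner_in M c x' b y) (at x) a
      + frechet_derivative (\<lambda>x'. ginner_in M c x' a y) (at x) b
      - frechet_derivative (\<lambda>x'. ginner_in M c x' a b) (at x) y) / 2)"

text \<open>\<open>D\<close> is the covariant derivative of \<open>X\<close> along \<open>\<gamma>\<close> at \<open>t\<close>: in the chart at \<open>\<gamma> t\<close>,
  \<open>D = X' + \<Gamma>(\<gamma>', X)\<close>.\<close>

definition has_covariant_derivative ::
    "('m, 'e::euclidean_space) riemannian \<Rightarrow> (real \<Rightarrow> 'm) \<Rightarrow> (real \<Rightarrow> 'e) \<Rightarrow> 'e \<Rightarrow> real \<Rightarrow> bool" where
  "has_covariant_derivative M \<gamma> X D t \<longleftrightarrow>
     (let c = chart_at M (\<gamma> t) in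
      ((\<lambda>s. components M c (\<gamma> s) (X s)) has_vector_derivative
         (D - christoffel M c (chart_map c (\<gamma> t)) (velocity M \<gamma> t) (X t))) (at t within {0..1}))"

definition covariant_derivative ::
    "('m, 'e::euclidean_space) riemannian \<Rightarrow> (real \<Rightarrow> 'm) \<Rightarrow> (real \<Rightarrow> 'e) \<Rightarrow> real \<Rightarrow> 'e" where
  "covariant_derivative M \<gamma> X t = (THE D. has_covariant_derivative M \<gamma> X D t)"

definition parallel_along ::
    "('m, 'e::euclidean_space) riemannian \<Rightarrow> (real \<Rightarrow> 'm) \<Rightarrow> (real \<Rightarrow> 'e) \<Rightarrow> bool" where
  "parallel_along M \<gamma> X \<longleftrightarrow> (\<forall>t\<in>{0..1}. has_covariant_derivative M \<gamma> X 0 t)"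

definition parallel_transport ::
    "('m, 'e::euclidean_space) riemannian \<Rightarrow> (real \<Rightarrow> 'm) \<Rightarrow> real \<Rightarrow> real \<Rightarrow> 'e \<Rightarrow> 'e" where
  "parallel_transport M \<gamma> s t v = (THE w. \<exists>X. parallel_along M \<gamma> X \<and> X s = v \<and> X t = w)"

section \<open>Exponential and logarithm maps\<close>

definition geodesic ::
    "('m::topological_space, 'e::euclidean_space) riemannian \<Rightarrow> (real \<Rightarrow> 'm) \<Rightarrow> bool" where
  "geodesic M \<sigma> \<longleftrightarrow> differentiable_curve M \<sigma> \<and> parallel_along M \<sigma> (velocity M \<sigma>)"

definition exp_rel ::
    "('m::topological_space, 'e::euclidean_space) riemannian \<Rightarrow> 'm \<Rightarrow> 'e \<Rightarrow> 'm \<Rightarrow> bool" where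
  "exp_rel M p v q \<longleftrightarrow> (\<exists>\<sigma>. geodesic M \<sigma> \<and> \<sigma> 0 = p \<and> velocity M \<sigma> 0 = v \<and> \<sigma> 1 = q)"

definition Exp ::
    "('m::topological_space, 'e::euclidean_space) riemannian \<Rightarrow> 'm \<Rightarrow> 'e \<Rightarrow> 'm" where
  "Exp M p v = (THE q. exp_rel M p v q)"

definition C1_curve ::
    "('m::topological_space, 'e::euclidean_space) riemannian \<Rightarrow> (real \<Rightarrow> 'm) \<Rightarrow> bool" where
  "C1_curve M \<gamma> \<longleftrightarrow> differentiable_curve M \<gamma> \<and>
     (\<forall>t\<in>{0..1}. continuous (at t within {0..1})
        (\<lambda>s. components M (chart_at M (\<gamma> t)) (\<gamma> s) (velocity M \<gamma> s)))"

text \<open>A \<open>C\<^sup>1\<close> curve may stop at a corner, so piecewise \<open>C\<^sup>1\<close> curves give the same infimum.\<close>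

definition riemannian_dist ::
    "('m::topological_space, 'e::euclidean_space) riemannian \<Rightarrow> 'm \<Rightarrow> 'm \<Rightarrow> real" where
  "riemannian_dist M p q =
     (INF \<gamma>\<in>{\<gamma>. C1_curve M \<gamma> \<and> \<gamma> 0 = p \<and> \<gamma> 1 = q}.
        integral {0..1} (\<lambda>t. gnorm M (\<gamma> t) (velocity M \<gamma> t)))"

text \<open>The initial velocity of a minimising geodesic from \<open>p\<close> to \<open>q\<close>. It is unique for \<open>q\<close> outside the
  cut locus of \<open>p\<close>; on the cut locus some minimising geodesic is chosen.\<close>

definition Log ::
    "('m::topological_space, 'e::euclidean_space) riemannian \<Rightarrow> 'm \<Rightarrow> 'm \<Rightarrow> 'e" where
  "Log M p q = (SOME v. exp_rel M p v q \<and> gnorm M p v = riemannian_dist M p q)"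

section \<open>Interpolation path, average velocity and objectives\<close>

definition interpolant ::
    "('m::topological_space, 'e::euclidean_space) riemannian \<Rightarrow> (real \<Rightarrow> real) \<Rightarrow> 'm \<Rightarrow> 'm
       \<Rightarrow> real \<Rightarrow> 'm" where
  "interpolant M \<kappa> x0 x1 \<tau> = Exp M x1 (\<kappa> \<tau> *\<^sub>R Log M x1 x0)"

definition inst_velocity ::
    "('m::topological_space, 'e::euclidean_space) riemannian \<Rightarrow> (real \<Rightarrow> real) \<Rightarrow> 'm \<Rightarrow> 'm
       \<Rightarrow> real \<Rightarrow> 'e" where
  "inst_velocity M \<kappa> x0 x1 t = velocity M (interpolant M \<kappa> x0 x1) t"

definition avg_velocity ::
    "('m::topological_space, 'e::euclidean_space) riemannian \<Rightarrow> (real \<Rightarrow> real) \<Rightarrow> 'm \<Rightarrow> 'm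
       \<Rightarrow> real \<Rightarrow> real \<Rightarrow> 'e" where
  "avg_velocity M \<kappa> x0 x1 r t =
     (1 / (t - r)) *\<^sub>R integral {r..t}
       (\<lambda>\<tau>. parallel_transport M (interpolant M \<kappa> x0 x1) \<tau> t (inst_velocity M \<kappa> x0 x1 \<tau>))"

definition cov_avg_velocity ::
    "('m::topological_space, 'e::euclidean_space) riemannian \<Rightarrow> (real \<Rightarrow> real) \<Rightarrow> 'm \<Rightarrow> 'm
       \<Rightarrow> real \<Rightarrow> real \<Rightarrow> 'e" where
  "cov_avg_velocity M \<kappa> x0 x1 r t =
     covariant_derivative M (interpolant M \<kappa> x0 x1) (\<lambda>s. avg_velocity M \<kappa> x0 x1 r s) t"

text \<open>The random variables under the expectations, at a sample \<open>(x0, x1, r, t)\<close>, for a network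
  \<open>f\<close> whose value \<open>f x r t\<close> is a tangent vector at \<open>x\<close>.\<close>

definition rmf_integrand ::
    "('m::topological_space, 'e::euclidean_space) riemannian \<Rightarrow> (real \<Rightarrow> real)
       \<Rightarrow> ('m \<Rightarrow> real \<Rightarrow> real \<Rightarrow> 'e) \<Rightarrow> 'm \<Rightarrow> 'm \<Rightarrow> real \<Rightarrow> real \<Rightarrow> real" where
  "rmf_integrand M \<kappa> f x0 x1 r t =
     (let x = interpolant M \<kappa> x0 x1 t in (gnorm M x (f x r t - avg_velocity M \<kappa> x0 x1 r t))\<^sup>2)"

definition L1_integrand ::
    "('m::topological_space, 'e::euclidean_space) riemannian \<Rightarrow> (real \<Rightarrow> real)
       \<Rightarrow> ('m \<Rightarrow> real \<Rightarrow> real \<Rightarrow> 'e) \<Rightarrow> 'm \<Rightarrow> 'm \<Rightarrow> real \<Rightarrow> real \<Rightarrow> real" where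
  "L1_integrand M \<kappa> f x0 x1 r t =
     (let x = interpolant M \<kappa> x0 x1 t in (gnorm M x (f x r t - inst_velocity M \<kappa> x0 x1 t))\<^sup>2)"

definition L2_integrand ::
    "('m::topological_space, 'e::euclidean_space) riemannian \<Rightarrow> (real \<Rightarrow> real)
       \<Rightarrow> ('m \<Rightarrow> real \<Rightarrow> real \<Rightarrow> 'e) \<Rightarrow> 'm \<Rightarrow> 'm \<Rightarrow> real \<Rightarrow> real \<Rightarrow> real" where
  "L2_integrand M \<kappa> f x0 x1 r t =
     (let x = interpolant M \<kappa> x0 x1 t in
      ginner M x (f x r t) ((t - r) *\<^sub>R cov_avg_velocity M \<kappa> x0 x1 r t))"

end

theory Submission
  imports Defs
begin

text \<open>With \<open>w = (t - r) \<nabla>u = v - u\<close>, expanding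
  \<open>\<parallel>u\<^sub>\<theta> - u\<parallel>\<^sup>2 = \<parallel>(u\<^sub>\<theta> - v) + w\<parallel>\<^sup>2\<close> leaves, besides \<open>\<parallel>u\<^sub>\<theta> - v\<parallel>\<^sup>2 + 2 \<langle>u\<^sub>\<theta>, w\<rangle>\<close>, only the
  \<open>\<theta>\<close>-free remainder \<open>\<parallel>w\<parallel>\<^sup>2 - 2 \<langle>v, w\<rangle> = \<parallel>u\<parallel>\<^sup>2 - \<parallel>v\<parallel>\<^sup>2\<close>.\<close>

text \<open>Positive definiteness keeps the radicand in \<open>gnorm\<close> nonnegative; it only
  speaks of nonzero vectors, hence the case split.\<close>

lemma gnorm_power2:
  assumes "riemannian_manifold M"
  shows "(gnorm M p v)\<^sup>2 = ginner M p v v"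
proof -
  have "bilinear (ginner M p)" and "v \<noteq> 0 \<Longrightarrow> ginner M p v v > 0"
    using assms by (auto simp: riemannian_manifold_def)
  then have "ginner M p v v \<ge> 0"
    by (cases "v = 0") (auto simp: bilinear_lzero)
  then show ?thesis
    by (simp add: gnorm_def)
qed

lemma gnorm_power2_diff:
  assumes M: "riemannian_manifold M" and u: "u = v - w"
  shows "(gnorm M p (f - u))\<^sup>2 - (gnorm M p (f - v))\<^sup>2 - 2 * ginner M p f w
    = (gnorm M p u)\<^sup>2 - (gnorm M p v)\<^sup>2"
proof -
  have bil: "bilinear (ginner M p)" and sym: "\<And>a b. ginner M p a b = ginner M p b a"
    using M by (auto simp: riemannian_manifold_def)
  show ?thesis
    unfolding gnorm_power2[OF M] u
    \<comment> \<open>These instances of symmetry put every mixed product into one order, so that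
      all terms with \<open>f\<close> cancel.\<close>
    by (simp add: bilinear_lsub[OF bil] bilinear_rsub[OF bil] sym[of v f] sym[of w f] sym[of w v])
qed

text \<open>The network \<open>f\<close> is absent from the right-hand side; this is the source of
  the independence of \<theta>.\<close>

lemma rmf_integrand_decomposition:
  assumes "riemannian_manifold M"
    and "avg_velocity M \<kappa> x0 x1 r t =
      inst_velocity M \<kappa> x0 x1 t - (t - r) *\<^sub>R cov_avg_velocity M \<kappa> x0 x1 r t"
  shows "rmf_integrand M \<kappa> f x0 x1 r t - L1_integrand M \<kappa> f x0 x1 r t
      - 2 * L2_integrand M \<kappa> f x0 x1 r t
    = (gnorm M (interpolant M \<kappa> x0 x1 t) (avg_velocity M \<kappa> x0 x1 r t))\<^sup>2
      - (gnorm M (interpolant M \<kappa> x0 x1 t) (inst_velocity M \<kappa> x0 x1 t))\<^sup>2"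
  using gnorm_power2_diff[OF assms]
  by (simp add: rmf_integrand_def L1_integrand_def L2_integrand_def Let_def)

theorem proposition3p2:
  fixes M :: "('m::{t2_space, second_countable_topology}, 'e::euclidean_space) riemannian"
    and \<kappa> :: "real \<Rightarrow> real"
    and P :: "'w measure"
    and X0 X1 :: "'w \<Rightarrow> 'm"
    and R T :: "'w \<Rightarrow> real"
    and p0 p1 :: "'m measure"
    and u\<theta> :: "'p \<Rightarrow> 'm \<Rightarrow> real \<Rightarrow> real \<Rightarrow> 'e"
  assumes manifold: "riemannian_manifold M"
    and kappa: "\<kappa> \<in> {0..1} \<rightarrow> {0..1}" "antimono_on {0..1} \<kappa>" "\<kappa> 0 = 1" "\<kappa> 1 = 0"
    and prob: "prob_space P"
    and rv: "X0 \<in> P \<rightarrow>\<^sub>M borel" "X1 \<in> P \<rightarrow>\<^sub>M borel"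
            "R \<in> P \<rightarrow>\<^sub>M borel" "T \<in> P \<rightarrow>\<^sub>M borel"
    and marginals: "distr P borel X0 = p0" "distr P borel X1 = p1"
    and times: "AE \<omega> in P. 0 \<le> R \<omega> \<and> R \<omega> < T \<omega> \<and> T \<omega> \<le> 1"
    and average_velocity_identity:
      "AE \<omega> in P. avg_velocity M \<kappa> (X0 \<omega>) (X1 \<omega>) (R \<omega>) (T \<omega>) =
         inst_velocity M \<kappa> (X0 \<omega>) (X1 \<omega>) (T \<omega>)
         - (T \<omega> - R \<omega>) *\<^sub>R cov_avg_velocity M \<kappa> (X0 \<omega>) (X1 \<omega>) (R \<omega>) (T \<omega>)"
    and finite_RMF: "\<And>\<theta>. integrable P
      (\<lambda>\<omega>. rmf_integrand M \<kappa> (u\<theta> \<theta>) (X0 \<omega>) (X1 \<omega>) (R \<omega>) (T \<omega>))"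
    and finite_L1: "\<And>\<theta>. integrable P
      (\<lambda>\<omega>. L1_integrand M \<kappa> (u\<theta> \<theta>) (X0 \<omega>) (X1 \<omega>) (R \<omega>) (T \<omega>))"
    and finite_L2: "\<And>\<theta>. integrable P
      (\<lambda>\<omega>. L2_integrand M \<kappa> (u\<theta> \<theta>) (X0 \<omega>) (X1 \<omega>) (R \<omega>) (T \<omega>))"
  shows "\<exists>C. \<forall>\<theta>.
    (\<integral>\<omega>. rmf_integrand M \<kappa> (u\<theta> \<theta>) (X0 \<omega>) (X1 \<omega>) (R \<omega>) (T \<omega>) \<partial>P) =
    (\<integral>\<omega>. L1_integrand M \<kappa> (u\<theta> \<theta>) (X0 \<omega>) (X1 \<omega>) (R \<omega>) (T \<omega>) \<partial>P)
    + 2 * (\<integral>\<omega>. L2_integrand M \<kappa> (u\<theta> \<theta>) (X0 \<omega>) (X1 \<omega>) (R \<omega>) (T \<omega>) \<partial>P) + C"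
proof -
  define rmf where "rmf \<theta> \<omega> = rmf_integrand M \<kappa> (u\<theta> \<theta>) (X0 \<omega>) (X1 \<omega>) (R \<omega>) (T \<omega>)" for \<theta> \<omega>
  define l1 where "l1 \<theta> \<omega> = L1_integrand M \<kappa> (u\<theta> \<theta>) (X0 \<omega>) (X1 \<omega>) (R \<omega>) (T \<omega>)" for \<theta> \<omega>
  define l2 where "l2 \<theta> \<omega> = L2_integrand M \<kappa> (u\<theta> \<theta>) (X0 \<omega>) (X1 \<omega>) (R \<omega>) (T \<omega>)" for \<theta> \<omega>
  define rest where "rest \<theta> \<omega> = rmf \<theta> \<omega> - l1 \<theta> \<omega> - 2 * l2 \<theta> \<omega>" for \<theta> \<omega>
  have int: "integrable P (rmf \<theta>)" "integrable P (l1 \<theta>)" "integrable P (l2 \<theta>)" for \<theta>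
    using finite_RMF finite_L1 finite_L2 unfolding rmf_def l1_def l2_def by blast+
  \<comment> \<open>Equality almost everywhere gives equal integrals through
    \<open>integral_cong_AE\<close> only if both integrands are measurable.\<close>
  have meas: "rest \<theta> \<in> borel_measurable P" for \<theta>
    unfolding rest_def using int[THEN borel_measurable_integrable] by measurable
  \<comment> \<open>The common value \<open>\<parallel>u\<parallel>\<^sup>2 - \<parallel>v\<parallel>\<^sup>2\<close> is not known to be measurable (the identity holds only almost
    everywhere and \<open>P\<close> need not be complete), so \<open>C\<close> is taken at a reference parameter instead.\<close>
  have "AE \<omega> in P. rest \<theta> \<omega> = rest undefined \<omega>" for \<theta>
    using average_velocity_identity
    by eventually_elim
      (simp add: rest_def rmf_def l1_def l2_def rmf_integrand_decomposition[OF manifold])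
  then have const: "(\<integral>\<omega>. rest \<theta> \<omega> \<partial>P) = (\<integral>\<omega>. rest undefined \<omega> \<partial>P)" for \<theta>
    by (intro integral_cong_AE meas)
  have "(\<integral>\<omega>. rest \<theta> \<omega> \<partial>P) = (\<integral>\<omega>. rmf \<theta> \<omega> \<partial>P) - (\<integral>\<omega>. l1 \<theta> \<omega> \<partial>P) - 2 * (\<integral>\<omega>. l2 \<theta> \<omega> \<partial>P)" for \<theta>
    unfolding rest_def using int[of \<theta>] by simp
  \<comment> \<open>The integral of \<open>rest undefined\<close> mentions no \<theta>, so it serves
    as the witness for \<open>C\<close>.\<close>
  then have "(\<integral>\<omega>. rmf \<theta> \<omega> \<partial>P) = (\<integral>\<omega>. l1 \<theta> \<omega> \<partial>P) + 2 * (\<integral>\<omega>. l2 \<theta> \<omega> \<partial>P)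
      + (\<integral>\<omega>. rest undefined \<omega> \<partial>P)" for \<theta>
    using const[of \<theta>] by simp
  then show ?thesis
    unfolding rmf_def l1_def l2_def by blast
qed

end
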